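(* Let $\mathcal H$ be a complex Hilbert space (of arbitrary dimension) and let $T$ be a bounded operator on $\mathcal H$ with $W(T)\subset\mathcal S_{\pi/4}=\{re^{i\theta}:r\ge0,\ |\theta|\le\pi/4\}$. If $c\in\mathbb C$ satisfies $$|\Im c|\le1,\qquad |\Re c|\le\frac{(1-|\Im c|)^2}{200},$$ then $$\Bigl\|\bigl((T^2-I)^2+\bar c(T^2+I)^2\bigr)\bigl((T^2+I)^2+c(T^2-I)^2\bigr)^{-1}\Bigr\|\le\sqrt2 .$$ At the tips $c=\pm i$ the quotient is understood after cancellation of the common polynomial factor.
   Context: $W(T)=\{\langle Tx,x\rangle:\|x\|=1\}$ is the numerical range. At $c=\pm i$ the numerator is a scalar multiple of the denominator, and the quotient after cancellation is the corresponding constant. *)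

theory Defs
  imports "HOL-Analysis.Analysis" "HOL-Computational_Algebra.Polynomial_Factorial"
    "HOL-Computational_Algebra.Field_as_Ring"
begin

text \<open>The scalar multiplication by complex numbers extends the real one, and the inner product
  (linear in the first argument) induces the norm; positive definiteness is part of
  \<open>cinner_self\<close>.\<close>

class complex_inner = real_normed_vector +
  fixes scaleC :: "complex \<Rightarrow> 'a \<Rightarrow> 'a" (infixr "*\<^sub>C" 75)
    and cinner :: "'a \<Rightarrow> 'a \<Rightarrow> complex"
  assumes scaleC_add_right: "a *\<^sub>C (x + y) = a *\<^sub>C x + a *\<^sub>C y"
    and scaleC_add_left: "(a + b) *\<^sub>C x = a *\<^sub>C x + b *\<^sub>C x"
    and scaleC_scaleC: "a *\<^sub>C (b *\<^sub>C x) = (a * b) *\<^sub>C x"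
    and scaleC_of_real: "complex_of_real r *\<^sub>C x = scaleR r x"
    and cinner_commute: "cinner x y = cnj (cinner y x)"
    and cinner_add_left: "cinner (x + y) z = cinner x z + cinner y z"
    and cinner_scaleC_left: "cinner (a *\<^sub>C x) y = a * cinner x y"
    and cinner_self: "cinner x x = complex_of_real ((norm x)\<^sup>2)"

class complex_hilbert = complex_inner + complete_space

definition bounded_clinear :: "('a::complex_inner \<Rightarrow> 'a) \<Rightarrow> bool" where
  "bounded_clinear T \<longleftrightarrow> bounded_linear T \<and> (\<forall>a x. T (a *\<^sub>C x) = a *\<^sub>C T x)"

definition invertible_op :: "('a::complex_inner \<Rightarrow> 'a) \<Rightarrow> bool" where
  "invertible_op A \<longleftrightarrow> (\<exists>B. bounded_clinear B \<and> A \<circ> B = id \<and> B \<circ> A = id)"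

definition numerical_range :: "('a::complex_inner \<Rightarrow> 'a) \<Rightarrow> complex set" where
  "numerical_range T = {cinner (T x) x | x. norm x = 1}"

definition sector :: "real \<Rightarrow> complex set" where
  "sector \<phi> = {complex_of_real r * exp (\<i> * complex_of_real \<theta>) | r \<theta>. 0 \<le> r \<and> \<bar>\<theta>\<bar> \<le> \<phi>}"

definition num_op :: "complex \<Rightarrow> ('a::complex_inner \<Rightarrow> 'a) \<Rightarrow> 'a \<Rightarrow> 'a" where
  "num_op c T = (\<lambda>x. ((\<lambda>y. (T ^^ 2) y - y) ^^ 2) x + cnj c *\<^sub>C ((\<lambda>y. (T ^^ 2) y + y) ^^ 2) x)"

definition den_op :: "complex \<Rightarrow> ('a::complex_inner \<Rightarrow> 'a) \<Rightarrow> 'a \<Rightarrow> 'a" where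
  "den_op c T = (\<lambda>x. ((\<lambda>y. (T ^^ 2) y + y) ^^ 2) x + c *\<^sub>C ((\<lambda>y. (T ^^ 2) y - y) ^^ 2) x)"

definition poly_op :: "complex poly \<Rightarrow> ('a::complex_inner \<Rightarrow> 'a) \<Rightarrow> 'a \<Rightarrow> 'a" where
  "poly_op p T = (\<lambda>x. \<Sum>i\<le>degree p. coeff p i *\<^sub>C (T ^^ i) x)"

definition num_poly :: "complex \<Rightarrow> complex poly" where
  "num_poly c = ([:0, 1:]\<^sup>2 - 1)\<^sup>2 + smult (cnj c) (([:0, 1:]\<^sup>2 + 1)\<^sup>2)"

definition den_poly :: "complex \<Rightarrow> complex poly" where
  "den_poly c = ([:0, 1:]\<^sup>2 + 1)\<^sup>2 + smult c (([:0, 1:]\<^sup>2 - 1)\<^sup>2)"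

definition cancel_num :: "complex poly \<Rightarrow> complex poly \<Rightarrow> complex poly" where
  "cancel_num p q = p div gcd p q"

definition cancel_den :: "complex poly \<Rightarrow> complex poly \<Rightarrow> complex poly" where
  "cancel_den p q = q div gcd p q"

text \<open>The operators \<open>num_op\<close> and \<open>den_op\<close> are the polynomials \<open>num_poly\<close> and \<open>den_poly\<close>
  evaluated at \<open>T\<close>.\<close>

lemma poly_op_upto:
  assumes "degree p \<le> n"
  shows "poly_op p T x = (\<Sum>i\<le>n. coeff p i *\<^sub>C (T ^^ i) x)"
proof -
  have z: "0 *\<^sub>C y = 0" for y :: 'a
    using scaleC_of_real[of 0 y] by simp
  show ?thesis
    unfolding poly_op_def
    by (rule sum.mono_neutral_left) (use assms in \<open>auto simp: coeff_eq_0 z\<close>)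
qed

lemma quadratic_ops:
  fixes T :: "'a::complex_inner \<Rightarrow> 'a"
  assumes "bounded_clinear T"
  shows "((\<lambda>y. (T ^^ 2) y - y) ^^ 2) x = (T ^^ 4) x - 2 *\<^sub>R (T ^^ 2) x + x"
    and "((\<lambda>y. (T ^^ 2) y + y) ^^ 2) x = (T ^^ 4) x + 2 *\<^sub>R (T ^^ 2) x + x"
proof -
  have l: "linear T"
    using assms by (simp add: bounded_clinear_def bounded_linear.linear)
  show "((\<lambda>y. (T ^^ 2) y - y) ^^ 2) x = (T ^^ 4) x - 2 *\<^sub>R (T ^^ 2) x + x"
    "((\<lambda>y. (T ^^ 2) y + y) ^^ 2) x = (T ^^ 4) x + 2 *\<^sub>R (T ^^ 2) x + x"
    by (simp_all add: numeral_eq_Suc linear_add[OF l] linear_diff[OF l] algebra_simps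
        scaleR_add_left[of 1 1, simplified] flip: scaleR_2)
qed

lemma poly_op_num_den:
  fixes T :: "'a::complex_inner \<Rightarrow> 'a"
  assumes "bounded_clinear T"
  shows "poly_op (num_poly c) T = num_op c T" and "poly_op (den_poly c) T = den_op c T"
proof -
  have m: "(a + b) *\<^sub>C y = a *\<^sub>C y + b *\<^sub>C y" "complex_of_real r *\<^sub>C y = r *\<^sub>R y" for a b r and y :: 'a
    by (simp_all add: scaleC_add_left scaleC_of_real)
  have z: "0 *\<^sub>C y = 0" "1 *\<^sub>C y = y" "2 *\<^sub>C y = 2 *\<^sub>R y" "(-2) *\<^sub>C y = - (2 *\<^sub>R y)" for y :: 'a
    using m(2)[of 0 y] m(2)[of 1 y] m(2)[of 2 y] m(2)[of "-2" y] by simp_all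
  have r: "a *\<^sub>C (r *\<^sub>R y) = (a * of_real r) *\<^sub>C y" "a *\<^sub>C (- y) = (- a) *\<^sub>C y" for a r and y :: 'a
    using m(2)[of r y] m(2)[of "-1" y] scaleC_scaleC[of a "of_real r" y] scaleC_scaleC[of a "-1" y]
    by simp_all
  have d: "a *\<^sub>C (x - y) = a *\<^sub>C x + (- a) *\<^sub>C y" for a and x y :: 'a
    using scaleC_add_right[of a x "- y"] r by simp
  have e: "(a - b) *\<^sub>C y = a *\<^sub>C y - b *\<^sub>C y" for a b and y :: 'a
    using scaleC_add_left[of "a - b" b y] by (simp add: algebra_simps)
  have n: "(- a) *\<^sub>C y = - (a *\<^sub>C y)" for a and y :: 'a
    using e[of 0 a y] z(1)[of y] by simp
  have np: "num_poly c = [:1 + cnj c, 0, -2 + cnj c * 2, 0, 1 + cnj c:]"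
    and dp: "den_poly c = [:1 + c, 0, 2 + (- c * 2), 0, 1 + c:]"
    by (simp_all add: num_poly_def den_poly_def power2_eq_square one_pCons algebra_simps)
  have *: "{..4::nat} = {0,1,2,3,4}" by auto
  show "poly_op (num_poly c) T = num_op c T"
  proof
    fix x
    have "degree (num_poly c) \<le> 4" unfolding np by (simp add: degree_pCons_eq_if)
    from poly_op_upto[OF this, of T x] show "poly_op (num_poly c) T x = num_op c T x"
      unfolding * num_op_def quadratic_ops[OF assms]
      by (simp add: np z m e n r d scaleC_add_right coeff_pCons eval_nat_numeral algebra_simps)
  qed
  show "poly_op (den_poly c) T = den_op c T"
  proof
    fix x
    have "degree (den_poly c) \<le> 4" unfolding dp by (simp add: degree_pCons_eq_if)
    from poly_op_upto[OF this, of T x] show "poly_op (den_poly c) T x = den_op c T x"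
      unfolding * den_op_def quadratic_ops[OF assms]
      by (simp add: dp z m e n r d scaleC_add_right coeff_pCons eval_nat_numeral algebra_simps)
  qed
qed

end

theory Submission
  imports Defs
begin

text \<open>
  Write \<open>S = T\<^sup>4 + I\<close> and \<open>B = 2 T\<^sup>2\<close>, so that the denominator is \<open>S + B + c (S - B)\<close> and the
  numerator \<open>S - B + cnj c (S + B)\<close>. Away from the tips the denominator \<open>D\<close> is invertible, and the norm bound
  says that \<open>2 \<parallel>D y\<parallel>\<^sup>2 - \<parallel>N y\<parallel>\<^sup>2 \<ge> 0\<close> for every vector \<open>y\<close>. With \<open>h = \<bar>Im c\<bar>\<close>,
  \<open>e = \<plusminus>1\<close> the sign of \<open>Im c\<close>, and \<open>S\<close>, \<open>B\<close> now standing for \<open>S y\<close>, \<open>B y\<close>, this difference equals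
    \<open>2 h \<parallel>S - e \<i> B\<parallel>\<^sup>2 + ((1 - h)\<^sup>2 + (Re c)\<^sup>2) (\<parallel>S\<parallel>\<^sup>2 + \<parallel>B\<parallel>\<^sup>2) + 2 Re c (\<parallel>S\<parallel>\<^sup>2 - \<parallel>B\<parallel>\<^sup>2)
      + 6 (1 - \<bar>c\<bar>\<^sup>2) Re \<langle>S, B\<rangle>\<close>.
  The hypothesis on \<open>Re c\<close> keeps the third term below one percent of the second, so only the last
  term can be harmful, and only if \<open>Re \<langle>S, B\<rangle> < 0\<close>. Two inequalities that do not
  involve \<open>c\<close> then bound the first two terms by multiples of \<open>- Re \<langle>S, B\<rangle>\<close>:
    \<open>\<parallel>S \<mp> \<i> B\<parallel>\<^sup>2 + 2 \<surd>2 Re \<langle>S, B\<rangle> \<ge> 0\<close>, useful near the tips \<open>c = \<plusminus>\<i>\<close>, and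
    \<open>\<parallel>S\<parallel>\<^sup>2 + \<parallel>B\<parallel>\<^sup>2 + 8 Re \<langle>S, B\<rangle> \<ge> 0\<close>, useful near the centre \<open>c = 0\<close>.
  These are the lemmas \<open>quartic_bound_at_tip\<close> and \<open>quartic_bound_at_centre\<close>. What remains is a
  quadratic inequality in \<open>h\<close> alone, which holds with little to spare.

  Both inequalities come from writing the left-hand side, for the tips after a partial fraction
  decomposition, as a positive combination of squares \<open>\<parallel>q(T) y\<parallel>\<^sup>2\<close> and of terms
  \<open>Re ((1 \<plusminus> \<i>) \<langle>T x, x\<rangle>)\<close> with \<open>x\<close> a polynomial in \<open>T\<close> applied to \<open>y\<close>. Such terms are
  nonnegative exactly because the numerical range of \<open>T\<close> lies in the sector of half-angle
  \<open>\<pi>/4\<close>, which is the intersection of the two half-planes \<open>Re ((1 \<plusminus> \<i>) z) \<ge> 0\<close>.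

  For invertibility, the denominator factors into shifts \<open>T - z\<close> with \<open>z\<close> outside the sector as
  long as \<open>\<bar>c\<bar> < 1\<close>. A rotation makes such a shift strongly accretive, and a strongly accretive
  operator is invertible by Banach's fixed point theorem. At the tips, numerator and denominator are
  proportional by a factor of modulus one.
\<close>

section \<open>Complex inner products and bounded operators\<close>

global_interpretation cvec: vector_space "scaleC :: complex \<Rightarrow> 'a \<Rightarrow> 'a::complex_inner"
proof
  fix a b :: complex and x y :: 'a
  show "1 *\<^sub>C x = x" using scaleC_of_real[of 1 x] by simp
qed (simp_all add: scaleC_add_right scaleC_add_left scaleC_scaleC)

lemma scaleR_eq_scaleC: "r *\<^sub>R x = complex_of_real r *\<^sub>C x"
  by (simp add: scaleC_of_real)

lemma cinner_add_right: "cinner x (y + z) = cinner x y + cinner x z"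
  by (subst cinner_commute, subst cinner_add_left) (simp flip: cinner_commute)

lemma cinner_scaleC_right: "cinner x (a *\<^sub>C y) = cnj a * cinner x y"
  by (subst cinner_commute, subst cinner_scaleC_left) (simp flip: cinner_commute)

lemma cinner_minus_left: "cinner (- x) y = - cinner x y"
  using cinner_scaleC_left[of "-1" x y] by simp

lemma cinner_minus_right: "cinner x (- y) = - cinner x y"
  using cinner_scaleC_right[of x "-1" y] by simp

lemma cinner_diff_left: "cinner (x - y) z = cinner x z - cinner y z"
  using cinner_add_left[of x "- y" z] by (simp add: cinner_minus_left)

lemma cinner_diff_right: "cinner x (y - z) = cinner x y - cinner x z"
  using cinner_add_right[of x y "- z"] by (simp add: cinner_minus_right)

lemmas cinner_expand = cinner_add_left cinner_add_right cinner_diff_left cinner_diff_right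
  cinner_scaleC_left cinner_scaleC_right cinner_minus_left cinner_minus_right

lemma norm_sq_cinner: "(norm x)\<^sup>2 = Re (cinner x x)"
  by (simp add: cinner_self)

lemma Re_cinner_commute: "Re (cinner x y) = Re (cinner y x)"
  by (subst cinner_commute) simp

lemma Im_cinner_commute: "Im (cinner x y) = - Im (cinner y x)"
  by (subst cinner_commute) simp

lemma Im_cinner_self: "Im (cinner x x) = 0"
  by (simp add: cinner_self)

lemma norm_scaleC: "norm (a *\<^sub>C x) = cmod a * norm x"
proof -
  have "(norm (a *\<^sub>C x))\<^sup>2 = Re (a * cnj a) * (norm x)\<^sup>2"
    by (simp add: norm_sq_cinner cinner_expand Im_cinner_self algebra_simps)
  also have "\<dots> = (cmod a * norm x)\<^sup>2"
    by (simp add: complex_mult_cnj cmod_power2 power_mult_distrib)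
  finally show ?thesis by (simp add: power2_eq_iff_nonneg)
qed

lemma bounded_clinearD:
  assumes "bounded_clinear T"
  shows "T (x + y) = T x + T y" "T (x - y) = T x - T y" "T (- x) = - T x" "T 0 = 0"
    "T (a *\<^sub>C x) = a *\<^sub>C T x"
proof -
  interpret bounded_linear T using assms by (simp add: bounded_clinear_def)
  show "T (x + y) = T x + T y" "T (x - y) = T x - T y" "T (- x) = - T x" "T 0 = 0"
    by (simp_all add: add diff neg)
  show "T (a *\<^sub>C x) = a *\<^sub>C T x" using assms by (simp add: bounded_clinear_def)
qed

lemma bounded_clinearI:
  assumes "\<And>x y. T (x + y) = T x + T y" "\<And>a x. T (a *\<^sub>C x) = a *\<^sub>C T x"
    and "\<And>x. norm (T x) \<le> K * norm x"
  shows "bounded_clinear T"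
  unfolding bounded_clinear_def using assms
  by (auto intro!: bounded_linear_intro[where K = K] simp: scaleR_eq_scaleC mult.commute)

lemma bounded_clinear_compose:
  assumes "bounded_clinear A" "bounded_clinear B"
  shows "bounded_clinear (A \<circ> B)"
  using assms by (auto simp: bounded_clinear_def o_def intro: bounded_linear_compose)

lemma bounded_clinear_scaleC: "bounded_clinear ((*\<^sub>C) a)"
  by (rule bounded_clinearI[where K = "cmod a"])
     (simp_all add: scaleC_add_right scaleC_scaleC mult.commute norm_scaleC)

section \<open>Sectorial operators\<close>

text \<open>The condition that the numerical range lies in the sector of half-angle \<open>\<pi>/4\<close>, cleared of
  normalisation and of polar coordinates.\<close>

definition sectorial :: "('a::complex_inner \<Rightarrow> 'a) \<Rightarrow> bool" where
  "sectorial T \<longleftrightarrow> (\<forall>x. \<bar>Im (cinner (T x) x)\<bar> \<le> Re (cinner (T x) x))"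

lemma sector_quarter_pi:
  assumes "z \<in> sector (pi / 4)"
  shows "\<bar>Im z\<bar> \<le> Re z"
proof -
  obtain r t where z: "z = complex_of_real r * exp (\<i> * complex_of_real t)"
    and r: "0 \<le> r" and t: "\<bar>t\<bar> \<le> pi / 4"
    using assms by (auto simp: sector_def)
  have "\<bar>sin t\<bar> \<le> cos t"
  proof -
    have "0 \<le> sin \<bar>t\<bar>" using t by (intro sin_ge_zero) auto
    then have "\<bar>sin t\<bar> = sin \<bar>t\<bar>" by (cases "0 \<le> t") auto
    also have "\<dots> \<le> sin (pi / 4)" using t by (intro sin_monotone_2pi_le) auto
    also have "\<dots> = cos (pi / 4)" by (simp add: sin_45 cos_45)
    also have "\<dots> \<le> cos \<bar>t\<bar>" using t by (intro cos_monotone_0_pi_le) auto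
    finally show ?thesis by simp
  qed
  moreover have "Re z = r * cos t" "Im z = r * sin t"
    by (simp_all add: z Re_exp Im_exp)
  ultimately show ?thesis using r by (simp add: abs_mult mult_left_mono)
qed

lemma sectorial_if_numerical_range:
  assumes T: "bounded_clinear T" and W: "numerical_range T \<subseteq> sector (pi / 4)"
  shows "sectorial T"
  unfolding sectorial_def
proof
  fix x :: 'a
  show "\<bar>Im (cinner (T x) x)\<bar> \<le> Re (cinner (T x) x)"
  proof (cases "x = 0")
    case True
    then show ?thesis using cinner_scaleC_right[of "T x" 0 x] by simp
  next
    case False
    define u where "u = complex_of_real (inverse (norm x)) *\<^sub>C x"
    have "norm u = 1" using False by (simp add: u_def norm_scaleC norm_inverse)
    then have "cinner (T u) u \<in> sector (pi / 4)" using W by (auto simp: numerical_range_def)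
    then have u: "\<bar>Im (cinner (T u) u)\<bar> \<le> Re (cinner (T u) u)" by (rule sector_quarter_pi)
    have x: "x = complex_of_real (norm x) *\<^sub>C u"
      using False by (simp add: u_def)
    have "cinner (T x) x = complex_of_real ((norm x)\<^sup>2) * cinner (T u) u"
      using arg_cong[OF x, of "\<lambda>x. cinner (T x) x"]
      by (simp add: bounded_clinearD[OF T] cinner_expand power2_eq_square mult.assoc)
    then show ?thesis using u by (simp add: abs_mult mult_left_mono)
  qed
qed

text \<open>Accretivity of the two rotations of \<open>T\<close> by \<open>\<plusminus>\<pi>/4\<close>: the form in which sectoriality enters
  all sums of squares below.\<close>

lemma sectorial_rotated:
  assumes "sectorial T"
  shows "0 \<le> Re ((1 + \<i>) * cinner (T x) x)" "0 \<le> Re ((1 - \<i>) * cinner (T x) x)"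
  using assms by (auto simp: sectorial_def abs_le_iff algebra_simps) (smt (verit))+

section \<open>Two quartic inequalities\<close>

text \<open>Let \<open>\<zeta> = p (1 + e \<i>)\<close>, a point of the boundary of the sector. The left-hand side vanishes
  for the scalar operator \<open>T = \<zeta>\<close>, so each term of a certificate has to vanish there. This
  suggests the square of \<open>T\<^sup>2 - 2 p T + 2 p\<^sup>2\<close>, the real polynomial with zeros \<open>\<zeta>\<close> and its
  conjugate, together with the vector \<open>w = (T - \<zeta>) v\<close> for the half-plane that has \<open>\<zeta>\<close> in its interior.
  For the half-plane with \<open>\<zeta>\<close> on its boundary line the vector is unrestricted; with
  \<open>u = (T + \<zeta>) v\<close> the remaining terms match.\<close>

lemma quadratic_shift_bound:
  fixes T :: "'a::complex_inner \<Rightarrow> 'a"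
  assumes T: "bounded_clinear T" "sectorial T" and p: "0 \<le> p" and e: "e = 1 \<or> e = -1"
  shows "0 \<le> (norm (T (T v) - Complex 0 (2 * e * p\<^sup>2) *\<^sub>C v))\<^sup>2 + 8 * p\<^sup>2 * Re (cinner (T (T v)) v)"
proof -
  define w where "w = T v - Complex p (e * p) *\<^sub>C v"
  define u where "u = T v + Complex p (e * p) *\<^sub>C v"
  have e2: "e * e = 1" using e by auto
  have ee: "e * (e * t) = t" for t using e2 by (simp flip: mult.assoc)
  have "0 \<le> Re (Complex 1 (- e) * cinner (T w) w)" "0 \<le> Re (Complex 1 e * cinner (T u) u)"
    using e sectorial_rotated[OF T(2), of w] sectorial_rotated[OF T(2), of u] by auto
  then have pos: "0 \<le> 2 * p * Re (Complex 1 (- e) * cinner (T w) w)" "0 \<le> 2 * p * Re (Complex 1 e * cinner (T u) u)"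
    using p by auto
  define x1 x2 where x: "x1 = T v" "x2 = T (T v)"
  note comm = Re_cinner_commute[of v x1] Re_cinner_commute[of v x2] Re_cinner_commute[of x1 x2]
    Im_cinner_commute[of v x1] Im_cinner_commute[of v x2] Im_cinner_commute[of x1 x2]
  have Tuw: "T w = x2 - Complex p (e * p) *\<^sub>C x1" "T u = x2 + Complex p (e * p) *\<^sub>C x1"
    by (simp_all add: w_def u_def x bounded_clinearD[OF T(1)])
  \<comment> \<open>Both sides are real combinations of the Gram matrix of \<open>v\<close>, \<open>T v\<close>, \<open>T\<^sup>2 v\<close>.\<close>
  have "(norm (x2 - Complex 0 (2 * e * p\<^sup>2) *\<^sub>C v))\<^sup>2 + 8 * p\<^sup>2 * Re (cinner x2 v)
    = (norm (x2 - complex_of_real (2 * p) *\<^sub>C x1 + complex_of_real (2 * p\<^sup>2) *\<^sub>C v))\<^sup>2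
      + 2 * p * Re (Complex 1 (- e) * cinner (T w) w) + 2 * p * Re (Complex 1 e * cinner (T u) u)"
    unfolding Tuw unfolding w_def u_def norm_sq_cinner cinner_expand x(1)[symmetric]
    by (simp add: comm Im_cinner_self algebra_simps power2_eq_square ee e2)
  then show ?thesis using pos by (simp add: x)
qed

text \<open>With \<open>Q = T\<^sup>2\<close> the quartic splits as
  \<open>U = Q\<^sup>2 - 2 e \<i> Q + I = (Q - 2 e \<i> p\<^sup>2) (Q + 2 e \<i> r\<^sup>2)\<close>, where \<open>p\<^sup>2 - r\<^sup>2 = 1\<close> and
  \<open>4 p\<^sup>2 r\<^sup>2 = 1\<close>. The partial fraction expansion
  \<open>(p\<^sup>2 + r\<^sup>2) Q U\<^sup>-\<^sup>1 = p\<^sup>2 (Q - 2 e \<i> p\<^sup>2)\<^sup>-\<^sup>1 + r\<^sup>2 (Q + 2 e \<i> r\<^sup>2)\<^sup>-\<^sup>1\<close>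
  decouples the two factors, and the quadratic inequality applies to each of them. To avoid inverses,
  the two fractions applied to \<open>u = U y\<close> are written as the cofactors \<open>v\<close> and \<open>w\<close> applied to \<open>y\<close>.\<close>

lemma quartic_bound_at_tip:
  fixes T :: "'a::complex_inner \<Rightarrow> 'a"
  assumes T: "bounded_clinear T" "sectorial T" and e: "e = 1 \<or> e = -1"
  defines "Q \<equiv> \<lambda>x. T (T x)"
  shows "0 \<le> (norm (Q (Q y) - Complex 0 (2 * e) *\<^sub>C Q y + y))\<^sup>2 + 4 * sqrt 2 * Re (cinner (Q (Q y) + y) (Q y))"
proof -
  define p r where "p = sqrt ((sqrt 2 + 1) / 2)" and "r = sqrt ((sqrt 2 - 1) / 2)"
  have pr: "p\<^sup>2 = (sqrt 2 + 1) / 2" "r\<^sup>2 = (sqrt 2 - 1) / 2" "0 \<le> p" "0 \<le> r"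
    by (auto simp: p_def r_def)
  define v w u where "v = Q y + Complex 0 (2 * e * r\<^sup>2) *\<^sub>C y"
    and "w = Q y - Complex 0 (2 * e * p\<^sup>2) *\<^sub>C y"
    and "u = Q (Q y) - Complex 0 (2 * e) *\<^sub>C Q y + y"
  have "p\<^sup>2 * r\<^sup>2 = ((sqrt 2)\<^sup>2 - 1) / 4" unfolding pr by (simp add: field_simps power2_eq_square)
  then have pr4: "4 * (p\<^sup>2 * r\<^sup>2) = 1" by simp
  have diff: "p\<^sup>2 - r\<^sup>2 = 1" and sum: "p\<^sup>2 + r\<^sup>2 = sqrt 2" unfolding pr by (simp_all add: field_simps)
  have e2: "e * e = 1" using e by auto
  have c1: "Complex 0 (2 * e * p\<^sup>2) * Complex 0 (2 * e * r\<^sup>2) = - 1"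
    using pr4 e2 by (simp add: complex_eq_iff algebra_simps)
  have c2: "Complex 0 (2 * e * p\<^sup>2) - Complex 0 (2 * e * r\<^sup>2) = Complex 0 (2 * e)"
    using diff by (simp add: complex_eq_iff flip: right_diff_distrib)
  have uv: "u = Q v - Complex 0 (2 * e * p\<^sup>2) *\<^sub>C v"
    using c1 by (simp add: u_def v_def Q_def bounded_clinearD[OF T(1)] cvec.scale_right_distrib
        cvec.scale_left_diff_distrib flip: c2)
  have neg: "Complex 0 (2 * (- e) * r\<^sup>2) = - Complex 0 (2 * e * r\<^sup>2)"
    by (simp add: complex_eq_iff)
  have uw: "u = Q w - Complex 0 (2 * (- e) * r\<^sup>2) *\<^sub>C w"
    unfolding neg using c1[unfolded mult.commute[of "Complex 0 (2 * e * p\<^sup>2)"]]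
    by (simp add: u_def w_def Q_def bounded_clinearD[OF T(1)]
        cvec.scale_right_diff_distrib cvec.scale_left_diff_distrib flip: c2)
  have "complex_of_real (p\<^sup>2) * Complex 0 (2 * e * r\<^sup>2) = complex_of_real (r\<^sup>2) * Complex 0 (2 * e * p\<^sup>2)"
    by (simp add: complex_eq_iff)
  then have Qy: "complex_of_real (p\<^sup>2) *\<^sub>C v + complex_of_real (r\<^sup>2) *\<^sub>C w = complex_of_real (sqrt 2) *\<^sub>C Q y"
    by (simp add: v_def w_def cvec.scale_right_distrib cvec.scale_right_diff_distrib
        cvec.scale_left_distrib flip: sum)
  have Rv: "Re (cinner u v) = Re (cinner (Q v) v)"
    by (simp add: uv cinner_expand Im_cinner_self)
  have Rw: "Re (cinner u w) = Re (cinner (Q w) w)"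
    by (simp add: uw cinner_expand Im_cinner_self)
  have "0 \<le> (norm u)\<^sup>2 + 8 * p\<^sup>2 * Re (cinner u v)"
    using quadratic_shift_bound[OF T pr(3) e, of v] unfolding Rv unfolding uv Q_def .
  moreover have "0 \<le> (norm u)\<^sup>2 + 8 * r\<^sup>2 * Re (cinner u w)"
    using quadratic_shift_bound[OF T pr(4), of "- e" w] e unfolding Rw unfolding uw Q_def by auto
  moreover have "p\<^sup>2 * Re (cinner u v) + r\<^sup>2 * Re (cinner u w) = sqrt 2 * Re (cinner u (Q y))"
    using arg_cong[OF Qy, of "\<lambda>z. Re (cinner u z)"] by (simp add: cinner_expand)
  moreover have "Re (cinner u (Q y)) = Re (cinner (Q (Q y) + y) (Q y))"
    by (simp add: u_def cinner_expand Im_cinner_self)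
  ultimately show ?thesis unfolding u_def[symmetric] by (simp add: algebra_simps)
qed

text \<open>Every term is a form in \<open>y, T y, \<dots>, T\<^sup>4 y\<close>. After subtracting the square of \<open>(T - I)\<^sup>4\<close>,
  one looks for positive semidefinite \<open>4 \<times> 4\<close> matrices that combine the terms \<open>\<langle>T (T\<^sup>k y), T\<^sup>j y\<rangle>\<close>,
  one for each half-plane. The left-hand side is invariant under reversing coefficients, which corresponds
  to passing from \<open>T\<close> to its inverse and exchanges the half-planes; so the second matrix can be
  taken to be the reversal of the first. Comparing coefficients leaves a few free parameters, for which
  the matrix with rows \<open>(4, -3-5\<i>, 4, -5/2-5/2\<i>)\<close>, \<open>(-3+5\<i>, 20, -27/2-5/2\<i>, 4)\<close>,
  \<open>(4, -27/2+5/2\<i>, 20, -3-5\<i>)\<close>, \<open>(-5/2+5/2\<i>, 4, -3+5\<i>, 4)\<close>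
  is one positive definite choice.\<close>

lemma quartic_bound_at_centre:
  fixes T :: "'a::complex_inner \<Rightarrow> 'a"
  assumes T: "bounded_clinear T" "sectorial T"
  defines "Q \<equiv> \<lambda>x. T (T x)"
  shows "0 \<le> (norm (Q (Q y) + y))\<^sup>2 + 4 * (norm (Q y))\<^sup>2 + 16 * Re (cinner (Q (Q y) + y) (Q y))"
proof -
  define v0 v1 v2 v3 v4 where v: "v0 = y" "v1 = T y" "v2 = T (T y)" "v3 = T (T (T y))" "v4 = T (T (T (T y)))"
  note comm = Re_cinner_commute[of v0 v1] Re_cinner_commute[of v0 v2] Re_cinner_commute[of v0 v3]
    Re_cinner_commute[of v0 v4] Re_cinner_commute[of v1 v2] Re_cinner_commute[of v1 v3]
    Re_cinner_commute[of v1 v4] Re_cinner_commute[of v2 v3] Re_cinner_commute[of v2 v4]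
    Re_cinner_commute[of v3 v4]
    Im_cinner_commute[of v0 v1] Im_cinner_commute[of v0 v2] Im_cinner_commute[of v0 v3]
    Im_cinner_commute[of v0 v4] Im_cinner_commute[of v1 v2] Im_cinner_commute[of v1 v3]
    Im_cinner_commute[of v1 v4] Im_cinner_commute[of v2 v3] Im_cinner_commute[of v2 v4]
    Im_cinner_commute[of v3 v4]
  \<comment> \<open>In \<open>G\<close> the second half-plane sees the reversed list of coefficients.\<close>
  define P N where "P = (\<lambda>x. Re ((1 + \<i>) * cinner (T x) x))" and "N = (\<lambda>x. Re ((1 - \<i>) * cinner (T x) x))"
  define p where "p = (\<lambda>a b c d. a *\<^sub>C v0 + b *\<^sub>C v1 + c *\<^sub>C v2 + d *\<^sub>C v3)"
  have Tp: "T (p a b c d) = a *\<^sub>C v1 + b *\<^sub>C v2 + c *\<^sub>C v3 + d *\<^sub>C v4" for a b c d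
    by (simp add: p_def bounded_clinearD[OF T(1)] v)
  have nonneg: "0 \<le> P x" "0 \<le> N x" for x
    using sectorial_rotated[OF T(2)] by (simp_all add: P_def N_def)
  define G where "G = (\<lambda>a b c d. P (p a b c d) + N (p d c b a))"
  have G: "0 \<le> G a b c d" for a b c d using nonneg by (simp add: G_def)
  \<comment> \<open>The four weighted polynomials come from completing squares in that matrix,
    eliminating the coefficients of \<open>T\<^sup>3, I, T\<^sup>2, T\<close> in this order.\<close>
  have "(norm (v4 + v0))\<^sup>2 + 4 * (norm v2)\<^sup>2 + 16 * Re (cinner (v4 + v0) v2)
    = (norm (v4 - 4 *\<^sub>C v3 + 6 *\<^sub>C v2 - 4 *\<^sub>C v1 + v0))\<^sup>2
      + 1/16 * G (Complex (-5) 5) 8 (Complex (-6) 10) 8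
      + 1/56 * G 7 (Complex (-4) (-20)) (Complex (-8) 10) 0
      + 5/336 * G 0 (Complex (-21) 11) 24 0
      + 5/24 * G 0 1 0 0"
    unfolding G_def P_def N_def Tp unfolding p_def norm_sq_cinner cinner_expand
    by (simp add: comm Im_cinner_self algebra_simps)
  then show ?thesis using G by (simp add: v Q_def)
qed

section \<open>The norm inequality\<close>

lemma pencil_identity:
  fixes S B :: "'a::complex_inner"
  defines "R \<equiv> Re (cinner S B)" and "J \<equiv> Im (cinner S B)"
  shows "2 * (norm (S + B + c *\<^sub>C (S - B)))\<^sup>2 - (norm (S - B + cnj c *\<^sub>C (S + B)))\<^sup>2
    = (1 + (cmod c)\<^sup>2 + 2 * Re c) * (norm S)\<^sup>2 + (1 + (cmod c)\<^sup>2 - 2 * Re c) * (norm B)\<^sup>2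
      + 6 * (1 - (cmod c)\<^sup>2) * R - 4 * Im c * J"
  unfolding norm_sq_cinner cinner_expand R_def J_def cmod_power2
  by (simp add: Re_cinner_commute[of B S] Im_cinner_commute[of B S] Im_cinner_self algebra_simps power2_eq_square)

lemma norm_sq_diff_imaginary:
  fixes S B :: "'a::complex_inner"
  shows "(norm (S - Complex 0 e *\<^sub>C B))\<^sup>2 = (norm S)\<^sup>2 + e\<^sup>2 * (norm B)\<^sup>2 - 2 * e * Im (cinner S B)"
  unfolding norm_sq_cinner cinner_expand
  by (simp add: Re_cinner_commute[of B S] Im_cinner_commute[of B S] Im_cinner_self algebra_simps power2_eq_square)

lemma
  assumes T: "bounded_clinear T"
  shows den_op_split: "den_op c T y = (T (T (T (T y))) + y) + (T (T y) + T (T y))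
      + c *\<^sub>C ((T (T (T (T y))) + y) - (T (T y) + T (T y)))"
    and num_op_split: "num_op c T y = (T (T (T (T y))) + y) - (T (T y) + T (T y))
      + cnj c *\<^sub>C ((T (T (T (T y))) + y) + (T (T y) + T (T y)))"
proof -
  have "((\<lambda>z. (T ^^ 2) z - z) ^^ 2) y = (T (T (T (T y))) + y) - (T (T y) + T (T y))"
    "((\<lambda>z. (T ^^ 2) z + z) ^^ 2) y = (T (T (T (T y))) + y) + (T (T y) + T (T y))"
    unfolding quadratic_ops[OF T] by (simp_all add: eval_nat_numeral scaleR_2)
  then show "den_op c T y = (T (T (T (T y))) + y) + (T (T y) + T (T y))
      + c *\<^sub>C ((T (T (T (T y))) + y) - (T (T y) + T (T y)))"
    "num_op c T y = (T (T (T (T y))) + y) - (T (T y) + T (T y))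
      + cnj c *\<^sub>C ((T (T (T (T y))) + y) + (T (T y) + T (T y)))"
    by (simp_all only: den_op_def num_op_def)
qed

text \<open>If \<open>R = Re \<langle>S, B\<rangle>\<close> is nonnegative, so are the three summands of the expansion \<open>E\<close>
  (the middle one by \<open>margin\<close>). Otherwise the two quartic
  inequalities bound \<open>W\<close> and \<open>a + b\<close> from below by multiples of \<open>-R\<close>, and the claim becomes
  \<open>4 \<surd>2 h + 8 (99/100) (1 - h)\<^sup>2 \<ge> 6 (1 - h\<^sup>2)\<close>; here \<open>2 \<surd>2\<close> may be rounded down to \<open>14/5\<close>.\<close>

lemma norm_num_op_le:
  fixes T :: "'a::complex_inner \<Rightarrow> 'a"
  assumes T: "bounded_clinear T" "sectorial T"
    and c: "\<bar>Im c\<bar> \<le> 1" "\<bar>Re c\<bar> \<le> (1 - \<bar>Im c\<bar>)\<^sup>2 / 200"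
  shows "norm (num_op c T y) \<le> sqrt 2 * norm (den_op c T y)"
proof -
  define S B where "S = T (T (T (T y))) + y" and "B = T (T y) + T (T y)"
  define R J a b where "R = Re (cinner S B)" and "J = Im (cinner S B)"
    and "a = (norm S)\<^sup>2" and "b = (norm B)\<^sup>2"
  define h e where "h = \<bar>Im c\<bar>" and "e = (if 0 \<le> Im c then 1 else - 1 :: real)"
  define n where "n = (cmod c)\<^sup>2"
  define W where "W = a + b - 2 * e * J"
  have e: "e = 1 \<or> e = -1" "Im c = e * h" by (auto simp: e_def h_def)
  have B: "B = complex_of_real 2 *\<^sub>C T (T y)"
    unfolding B_def scaleC_of_real scaleR_2 ..
  have den: "den_op c T y = S + B + c *\<^sub>C (S - B)" and num: "num_op c T y = S - B + cnj c *\<^sub>C (S + B)"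
    unfolding S_def B_def by (rule den_op_split[OF T(1)] num_op_split[OF T(1)])+
  have b4: "b = 4 * (norm (T (T y)))\<^sup>2" 
    by (simp add: b_def B norm_scaleC power_mult_distrib)
  have R2: "R = 2 * Re (cinner S (T (T y)))" by (simp add: R_def B cinner_expand)
  have W_eq: "W = (norm (S - Complex 0 e *\<^sub>C B))\<^sup>2"
    using e(1) by (auto simp: W_def norm_sq_diff_imaginary a_def b_def J_def)
  have eB: "Complex 0 e *\<^sub>C B = Complex 0 (2 * e) *\<^sub>C T (T y)"
    by (simp add: B mult.commute complex_eq_iff)
  have tip: "0 \<le> W + 2 * sqrt 2 * R"
    using quartic_bound_at_tip[OF T e(1), of y]
    unfolding W_eq eB R2 S_def by (simp add: algebra_simps)
  have centre: "0 \<le> a + b + 8 * R"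
    using quartic_bound_at_centre[OF T, of y] unfolding b4 R2 a_def S_def by simp
  have pos: "0 \<le> W" "0 \<le> a" "0 \<le> b" unfolding W_eq a_def b_def by simp_all
  have h: "0 \<le> h" "h \<le> 1" using c by (auto simp: h_def)
  have n: "n = (Re c)\<^sup>2 + h\<^sup>2" by (simp add: n_def h_def cmod_power2)
  have x: "\<bar>Re c\<bar> \<le> (1 - h)\<^sup>2 / 200" using c by (simp add: h_def)
  have h1: "(1 - h)\<^sup>2 \<le> 1 - h" using h by (simp add: power2_eq_square mult_left_le)
  have "n \<le> 1"
  proof -
    have "\<bar>Re c\<bar> \<le> 1" using x h1 h by linarith
    then have "\<bar>Re c\<bar>\<^sup>2 \<le> \<bar>Re c\<bar>" unfolding power2_eq_square by (intro mult_left_le) auto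
    then have "(Re c)\<^sup>2 \<le> \<bar>Re c\<bar>" by simp
    moreover have "h\<^sup>2 \<le> h" using h by (simp add: power2_eq_square mult_left_le)
    ultimately show ?thesis using x h1 h unfolding n by linarith
  qed
  have E: "2 * (norm (den_op c T y))\<^sup>2 - (norm (num_op c T y))\<^sup>2
    = 2 * h * W + ((1 + n - 2 * h) * (a + b) + 2 * Re c * (a - b)) + 6 * (1 - n) * R"
    unfolding den num pencil_identity R_def[symmetric] J_def[symmetric] a_def[symmetric]
      b_def[symmetric] n_def[symmetric] e(2) W_def
    by (simp add: algebra_simps)
  \<comment> \<open>The asymmetry between \<open>a\<close> and \<open>b\<close> that \<open>Re c\<close> causes costs one percent.\<close>
  have margin: "(99/100 * (1 - h)\<^sup>2) * (a + b) \<le> (1 + n - 2 * h) * (a + b) + 2 * Re c * (a - b)"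
  proof -
    have "- (2 * Re c * (a - b)) \<le> \<bar>2 * Re c * (a - b)\<bar>" by simp
    also have "\<dots> \<le> 2 * \<bar>Re c\<bar> * (a + b)" 
      unfolding abs_mult using pos by (intro mult_mono) auto
    also have "\<dots> \<le> (1 - h)\<^sup>2 / 100 * (a + b)"
      using x pos by (intro mult_right_mono) auto
    finally have 1: "- (2 * Re c * (a - b)) \<le> (1 - h)\<^sup>2 / 100 * (a + b)" .
    have "(1 - h)\<^sup>2 \<le> 1 + n - 2 * h" unfolding n by (simp add: power2_eq_square algebra_simps)
    then have "(1 - h)\<^sup>2 * (a + b) \<le> (1 + n - 2 * h) * (a + b)"
      using pos by (intro mult_right_mono) auto
    moreover have "99/100 * (1 - h)\<^sup>2 * (a + b) = (1 - h)\<^sup>2 * (a + b) - (1 - h)\<^sup>2 / 100 * (a + b)"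
      by (simp add: field_simps)
    ultimately show ?thesis using 1 by linarith
  qed
  have "0 \<le> 2 * (norm (den_op c T y))\<^sup>2 - (norm (num_op c T y))\<^sup>2"
  proof (cases "0 \<le> R")
    case True
    have "0 \<le> (99/100 * (1 - h)\<^sup>2) * (a + b)" using pos by simp
    then have "0 \<le> (1 + n - 2 * h) * (a + b) + 2 * Re c * (a - b)" using margin by linarith
    moreover have "0 \<le> 2 * h * W" "0 \<le> 6 * (1 - n) * R"
      using True h pos \<open>n \<le> 1\<close> by simp_all
    ultimately show ?thesis unfolding E by linarith
  next
    case False
    define r where "r = - R"
    have r: "0 < r" using False by (simp add: r_def)
    have "14/5 * r \<le> 2 * sqrt 2 * r"
      using r real_le_rsqrt[of "7/5" 2] by (intro mult_right_mono) (simp_all add: power2_eq_square)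
    moreover have "2 * sqrt 2 * R = - (2 * sqrt 2 * r)" by (simp add: r_def)
    ultimately have W: "14/5 * r \<le> W" using tip by linarith
    have 1: "2 * h * (14/5 * r) \<le> 2 * h * W" using W h by (intro mult_left_mono) auto
    have 2: "(99/100 * (1 - h)\<^sup>2) * (8 * r) \<le> (99/100 * (1 - h)\<^sup>2) * (a + b)"
      using centre by (intro mult_left_mono) (auto simp: r_def)
    have 3: "6 * (1 - n) * r \<le> 6 * (1 - h\<^sup>2) * r"
      using r by (intro mult_right_mono) (auto simp: n)
    have "0 \<le> (48/25 - 256/25 * h + 348/25 * h\<^sup>2) * r"
    proof -
      \<comment> \<open>The minimum at \<open>h = 32/87\<close> is barely positive.\<close>
      have "48/25 - 256/25 * h + 348/25 * h\<^sup>2 = 348/25 * (h - 32/87)\<^sup>2 + 16/435"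
        by (simp add: field_simps power2_eq_square)
      then show ?thesis using r by simp
    qed
    also have "\<dots> = 2 * h * (14/5 * r) + (99/100 * (1 - h)\<^sup>2) * (8 * r) - 6 * (1 - h\<^sup>2) * r"
      by (simp add: field_simps power2_eq_square)
    finally have "6 * (1 - n) * r \<le> 2 * h * W + ((1 + n - 2 * h) * (a + b) + 2 * Re c * (a - b))"
      using 1 2 3 margin by linarith
    then show ?thesis unfolding E by (simp add: r_def)
  qed
  then have "(norm (num_op c T y))\<^sup>2 \<le> (sqrt 2 * norm (den_op c T y))\<^sup>2"
    by (simp add: power_mult_distrib)
  then show ?thesis by (rule power2_le_imp_le) simp
qed

section \<open>Invertibility of the denominator\<close>

lemma invertible_op_compose:
  assumes "invertible_op A" "invertible_op B"
  shows "invertible_op (A \<circ> B)"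
proof -
  obtain A' B' where A: "bounded_clinear A'" "A \<circ> A' = id" "A' \<circ> A = id"
    and B: "bounded_clinear B'" "B \<circ> B' = id" "B' \<circ> B = id"
    using assms by (auto simp: invertible_op_def)
  have "(A \<circ> B) \<circ> (B' \<circ> A') = id" "(B' \<circ> A') \<circ> (A \<circ> B) = id"
    using A B by (simp_all add: fun_eq_iff)
  then show ?thesis using bounded_clinear_compose[OF B(1) A(1)] by (auto simp: invertible_op_def)
qed

lemma invertible_op_scaleC:
  assumes "a \<noteq> 0"
  shows "invertible_op ((*\<^sub>C) a :: 'a::complex_inner \<Rightarrow> 'a)"
  unfolding invertible_op_def
  using assms by (intro exI[of _ "(*\<^sub>C) (inverse a)"]) (auto simp: bounded_clinear_scaleC fun_eq_iff)

text \<open>For a small step \<open>t > 0\<close> the map \<open>x \<mapsto> x - t A x\<close> shrinks norms by a factor \<open>q < 1\<close>, since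
  \<open>\<parallel>x - t A x\<parallel>\<^sup>2 \<le> (1 - 2 t d + t\<^sup>2 K\<^sup>2) \<parallel>x\<parallel>\<^sup>2\<close> with \<open>K\<close> a bound for \<open>A\<close>. Solutions of
  \<open>A x = y\<close> are the fixed points of the contraction \<open>x \<mapsto> x - t A x + t y\<close>. The contraction estimate
  also bounds the inverse.\<close>

lemma invertible_op_if_strongly_accretive:
  fixes A :: "'a::complex_hilbert \<Rightarrow> 'a"
  assumes A: "bounded_clinear A" and d: "0 < d" and acc: "\<And>x. d * (norm x)\<^sup>2 \<le> Re (cinner (A x) x)"
  shows "invertible_op A"
proof -
  obtain K where K: "0 < K" "\<And>x. norm (A x) \<le> norm x * K"
    using A bounded_linear.pos_bounded[of A] unfolding bounded_clinear_def by blast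
  \<comment> \<open>The summand \<open>d\<^sup>2\<close> only serves to make \<open>d t < 1\<close>, so that \<open>q\<close> is a square root of a positive number.\<close>
  define t where "t = d / (K\<^sup>2 + d\<^sup>2)"
  define q where "q = sqrt (1 - d * t)"
  have Kd: "0 < K\<^sup>2 + d\<^sup>2" using K by (simp add: add_pos_nonneg)
  have t: "0 < t" using d Kd by (simp add: t_def)
  have dt: "0 < d * t" "d * t < 1" 
    using d t K Kd by (auto simp: t_def power2_eq_square)
  have tK: "t\<^sup>2 * K\<^sup>2 \<le> t * d"
  proof -
    have "t * K\<^sup>2 \<le> t * (K\<^sup>2 + d\<^sup>2)" using t by simp
    also have "\<dots> = d" using Kd by (simp add: t_def)
    finally show ?thesis using t by (simp add: power2_eq_square mult.assoc mult_left_mono)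
  qed
  have q: "0 \<le> q" "q < 1" using dt by (auto simp: q_def)
  have contr: "norm (x - t *\<^sub>R A x) \<le> q * norm x" for x
  proof -
    have "(norm (x - t *\<^sub>R A x))\<^sup>2 = (norm x)\<^sup>2 - 2 * t * Re (cinner (A x) x) + t\<^sup>2 * (norm (A x))\<^sup>2"
      unfolding norm_sq_cinner scaleR_eq_scaleC cinner_expand
      by (simp add: Re_cinner_commute[of x "A x"] Im_cinner_self algebra_simps power2_eq_square)
    also have "\<dots> \<le> (norm x)\<^sup>2 - 2 * t * (d * (norm x)\<^sup>2) + t\<^sup>2 * (norm x * K)\<^sup>2"
      using t acc[of x] K(2)[of x] by (intro add_mono diff_mono mult_left_mono power_mono) auto
    also have "\<dots> = (norm x)\<^sup>2 - 2 * (d * t) * (norm x)\<^sup>2 + (t\<^sup>2 * K\<^sup>2) * (norm x)\<^sup>2"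
      by (simp add: algebra_simps power_mult_distrib)
    also have "\<dots> \<le> (norm x)\<^sup>2 - 2 * (d * t) * (norm x)\<^sup>2 + (t * d) * (norm x)\<^sup>2"
      by (intro add_left_mono mult_right_mono tK) simp
    also have "\<dots> = (q * norm x)\<^sup>2"
      using dt by (simp add: q_def power_mult_distrib algebra_simps)
    finally show ?thesis using q by (simp add: power2_le_iff_abs_le)
  qed
  have uniq: "\<exists>!x. A x = y" for y
  proof -
    have "\<exists>!x. x - t *\<^sub>R A x + t *\<^sub>R y = x"
    proof (rule banach_fix_type[OF q], intro allI)
      fix u v :: 'a
      have eq: "(u - t *\<^sub>R A u + t *\<^sub>R y) - (v - t *\<^sub>R A v + t *\<^sub>R y) = (u - v) - t *\<^sub>R A (u - v)"
        by (simp add: bounded_clinearD[OF A] algebra_simps)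
      show "dist (u - t *\<^sub>R A u + t *\<^sub>R y) (v - t *\<^sub>R A v + t *\<^sub>R y) \<le> q * dist u v"
        using contr[of "u - v"] unfolding dist_norm eq .
    qed
    moreover have "x - t *\<^sub>R A x + t *\<^sub>R y = x \<longleftrightarrow> A x = y" for x
      using t by (auto simp: algebra_simps)
    ultimately show ?thesis by simp
  qed
  define B where "B y = (THE x. A x = y)" for y
  have AB: "A (B y) = y" for y unfolding B_def by (rule theI'[OF uniq])
  have BA: "B (A x) = x" for x using uniq[of "A x"] AB[of "A x"] by auto
  have "bounded_clinear B"
  proof (rule bounded_clinearI)
    show "B (x + y) = B x + B y" for x y
      using BA[of "B x + B y"] by (simp add: bounded_clinearD[OF A] AB)
    show "B (a *\<^sub>C x) = a *\<^sub>C B x" for a x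
      using BA[of "a *\<^sub>C B x"] by (simp add: bounded_clinearD[OF A] AB)
    show "norm (B x) \<le> (t / (1 - q)) * norm x" for x
    proof -
      have "norm (B x) \<le> norm (B x - t *\<^sub>R A (B x)) + norm (t *\<^sub>R A (B x))"
        using norm_triangle_ineq[of "B x - t *\<^sub>R A (B x)" "t *\<^sub>R A (B x)"] by simp
      also have "\<dots> \<le> q * norm (B x) + t * norm x"
        using contr[of "B x"] t by (simp add: AB)
      finally show ?thesis using q by (simp add: field_simps)
    qed
  qed
  moreover have "A \<circ> B = id" "B \<circ> A = id" by (auto simp: AB BA)
  ultimately show ?thesis by (auto simp: invertible_op_def)
qed


text \<open>A point outside the sector violates one of the two half-plane conditions; rotating by the
  corresponding \<open>1 \<plusminus> \<i>\<close> makes \<open>T - z\<close> strongly accretive.\<close>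

lemma invertible_op_shift:
  fixes T :: "'a::complex_hilbert \<Rightarrow> 'a"
  assumes T: "bounded_clinear T" "sectorial T" and z: "Re z < \<bar>Im z\<bar>"
  shows "invertible_op (\<lambda>x. T x - z *\<^sub>C x)"
proof -
  define e where "e = (if 0 \<le> Im z then 1 else - 1 :: real)"
  define w where "w = Complex 1 e"
  have w: "w \<noteq> 0" "Re (w * z) < 0" using z by (auto simp: w_def e_def complex_eq_iff)
  define A where "A = (\<lambda>x. w *\<^sub>C (T x - z *\<^sub>C x))"
  obtain K where K: "\<And>x. norm (T x) \<le> norm x * K"
    using T(1) bounded_linear.pos_bounded[of T] unfolding bounded_clinear_def by blast
  have "bounded_clinear A"
  proof (rule bounded_clinearI)
    show "A (x + y) = A x + A y" "A (a *\<^sub>C x) = a *\<^sub>C A x" for a x y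
      by (simp_all add: A_def bounded_clinearD[OF T(1)] scaleC_add_right cvec.scale_right_diff_distrib
          algebra_simps)
    show "norm (A x) \<le> (cmod w * (K + cmod z)) * norm x" for x
    proof -
      have "norm (T x - z *\<^sub>C x) \<le> (K + cmod z) * norm x"
        using norm_triangle_ineq4[of "T x" "z *\<^sub>C x"] K[of x] by (simp add: norm_scaleC algebra_simps)
      then show ?thesis by (simp add: A_def norm_scaleC mult.assoc mult_left_mono)
    qed
  qed
  moreover have "0 < - Re (w * z)" using w by simp
  moreover have "- Re (w * z) * (norm x)\<^sup>2 \<le> Re (cinner (A x) x)" for x
  proof -
    have "0 \<le> Re (w * cinner (T x) x)"
      using sectorial_rotated[OF T(2), of x] by (auto simp: w_def e_def)
    moreover have "Re (cinner (A x) x) = Re (w * cinner (T x) x) - Re (w * z) * (norm x)\<^sup>2"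
      by (simp add: A_def cinner_expand cinner_self algebra_simps)
    ultimately show ?thesis by (simp only: minus_mult_left[symmetric])
  qed
  ultimately have "invertible_op A" by (rule invertible_op_if_strongly_accretive)
  then have "invertible_op ((*\<^sub>C) (inverse w) \<circ> A)"
    using w by (intro invertible_op_compose invertible_op_scaleC) auto
  moreover have "(*\<^sub>C) (inverse w) \<circ> A = (\<lambda>x. T x - z *\<^sub>C x)"
    using w by (auto simp: A_def fun_eq_iff)
  ultimately show ?thesis by simp
qed

text \<open>Both square roots \<open>\<plusminus>z\<close> of \<open>-g\<close> satisfy \<open>\<bar>Re z\<bar> < \<bar>Im z\<bar>\<close> and hence lie outside the
  sector, so both factors of \<open>T\<^sup>2 - z\<^sup>2\<close> are invertible.\<close>

lemma invertible_op_square_shift: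
  fixes T :: "'a::complex_hilbert \<Rightarrow> 'a"
  assumes T: "bounded_clinear T" "sectorial T" and g: "0 < Re g"
  shows "invertible_op (\<lambda>x. T (T x) + g *\<^sub>C x)"
proof -
  define z where "z = csqrt (- g)"
  have zz: "z * z = - g" using power2_csqrt[of "- g"] by (simp add: z_def power2_eq_square)
  then have "(Re z)\<^sup>2 < (Im z)\<^sup>2" using g by (auto simp: complex_eq_iff power2_eq_square)
  then have "\<bar>Re z\<bar> < \<bar>Im z\<bar>" by (rule power2_less_imp_less[of "\<bar>Re z\<bar>" "\<bar>Im z\<bar>", unfolded power2_abs]) simp
  then have "invertible_op ((\<lambda>x. T x - z *\<^sub>C x) \<circ> (\<lambda>x. T x - (- z) *\<^sub>C x))"
    by (intro invertible_op_compose invertible_op_shift T) auto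
  moreover have "(\<lambda>x. T x - z *\<^sub>C x) \<circ> (\<lambda>x. T x - (- z) *\<^sub>C x) = (\<lambda>x. T (T x) + g *\<^sub>C x)"
    using zz by (auto simp: fun_eq_iff bounded_clinearD[OF T(1)] cvec.scale_right_distrib algebra_simps)
  ultimately show ?thesis by simp
qed

text \<open>With \<open>d\<^sup>2 = -c\<close> the denominator is a difference of squares,
  \<open>(T\<^sup>2 + I)\<^sup>2 - d\<^sup>2 (T\<^sup>2 - I)\<^sup>2 = (1 - d\<^sup>2) (T\<^sup>2 + g) (T\<^sup>2 + 1/g)\<close>, where \<open>g = (1 - d)/(1 + d)\<close> is the
  Cayley transform of \<open>d\<close> and has positive real part because \<open>\<bar>d\<bar> < 1\<close>.\<close>

lemma invertible_den_op:
  fixes T :: "'a::complex_hilbert \<Rightarrow> 'a"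
  assumes T: "bounded_clinear T" "sectorial T" and c: "cmod c < 1"
  shows "invertible_op (den_op c T)"
proof -
  define d where "d = csqrt (- c)"
  have dd: "d * d = - c" using power2_csqrt[of "- c"] by (simp add: d_def power2_eq_square)
  have "cmod d * cmod d < 1" using c by (simp flip: norm_mult add: dd)
  then have d: "cmod d < 1" by (metis linorder_not_less mult_mono' mult_1 norm_ge_zero zero_le_one)
  then have ne: "1 + d \<noteq> 0" "1 - d \<noteq> 0" by (auto simp: add_eq_0_iff)
  have Re_pos: "0 < Re ((1 - f) / (1 + f))" if "cmod f < 1" for f
  proof -
    have "0 < 1 - (cmod f)\<^sup>2" using that by (simp add: power_less_one_iff abs_square_less_1)
    moreover have "1 + f \<noteq> 0" using that by (auto simp: add_eq_0_iff)
    moreover have "Re ((1 - f) / (1 + f)) = (1 - (cmod f)\<^sup>2) / (cmod (1 + f))\<^sup>2"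
      unfolding Re_divide cmod_power2 by (simp add: power2_eq_square algebra_simps)
    ultimately show ?thesis by simp
  qed
  define g g' where "g = (1 - d) / (1 + d)" and "g' = (1 + d) / (1 - d)"
  have g: "0 < Re g" "0 < Re g'" using Re_pos[of d] Re_pos[of "- d"] d by (simp_all add: g_def g'_def)
  define F where "F = (*\<^sub>C) (1 - d * d) \<circ> ((\<lambda>x. T (T x) + g *\<^sub>C x) \<circ> (\<lambda>x. T (T x) + g' *\<^sub>C x))"
  have fac: "1 - d * d = (1 + d) * (1 - d)" by (simp add: algebra_simps)
  then have "1 - d * d \<noteq> 0" using ne by simp
  then have "invertible_op F"
    unfolding F_def by (intro invertible_op_compose invertible_op_scaleC invertible_op_square_shift T g)
  moreover have "F = den_op c T"
  proof
    fix x
    have gg: "g * g' = 1" using ne by (simp add: g_def g'_def)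
    have gs: "(1 - d * d) * (g + g') = (1 + d * d) + (1 + d * d)"
    proof -
      have "(1 - d * d) * g = (1 - d) * (1 - d)" "(1 - d * d) * g' = (1 + d) * (1 + d)"
        using ne unfolding fac by (simp_all add: g_def g'_def)
      then show ?thesis by (simp add: distrib_left) (simp add: algebra_simps)
    qed
    have two: "2 *\<^sub>C z = z + z" "(c * 2) *\<^sub>C z = c *\<^sub>C z + c *\<^sub>C z" for z :: 'a
      using cvec.scale_left_distrib[of 1 1 z] cvec.scale_left_distrib[of c c z] by (simp_all add: mult.commute)
    have "F x = (1 - d * d) *\<^sub>C T (T (T (T x))) + ((1 - d * d) * (g + g')) *\<^sub>C T (T x) + ((1 - d * d) * (g * g')) *\<^sub>C x"
      by (simp add: F_def bounded_clinearD[OF T(1)] cvec.scale_right_distrib cvec.scale_left_distrib algebra_simps)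
    also have "\<dots> = den_op c T x"
      unfolding gs gg unfolding dd den_op_split[OF T(1)]
      by (simp add: two cvec.scale_right_distrib cvec.scale_left_distrib 
          cvec.scale_right_diff_distrib cvec.scale_left_diff_distrib algebra_simps)
    finally show "F x = den_op c T x" .
  qed
  ultimately show ?thesis by simp
qed

section \<open>The quotient\<close>

lemma onorm_quotient_le:
  assumes D: "invertible_op D" and k: "0 \<le> k" and "\<And>x. norm (N x) \<le> k * norm (D x)"
  shows "onorm (N \<circ> inv D) \<le> k"
proof (rule onorm_bound[OF k])
  fix x
  obtain B where "D \<circ> B = id" using D by (auto simp: invertible_op_def)
  then have "surj D" by (intro surjI[of D B]) (simp add: fun_eq_iff)
  then have "D (inv D x) = x" by (rule surj_f_inv_f)
  then show "norm ((N \<circ> inv D) x) \<le> k * norm x" using assms(3)[of "inv D x"] by simp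
qed

text \<open>Proportional polynomials cancel to constants. The constant \<open>k\<close> is whatever the
  normalisation of the greatest common divisor leaves; it drops out of the quotient.\<close>

lemma cancel_smult:
  fixes q :: "complex poly"
  assumes q: "q \<noteq> 0"
  obtains k where "k \<noteq> 0" "cancel_den (smult a q) q = [:k:]" "cancel_num (smult a q) q = [:a * k:]"
proof -
  define g where "g = gcd (smult a q) q"
  have "q dvd g" "g dvd q" by (auto simp: g_def dvd_smult)
  then obtain u where u: "q = g * u" by (auto elim: dvdE)
  have "g \<noteq> 0" using q u by auto
  have "is_unit u" using \<open>q dvd g\<close> \<open>g \<noteq> 0\<close> u by (metis dvd_times_left_cancel_iff mult.right_neutral)
  then obtain k where k: "u = [:k:]" "k \<noteq> 0" by (auto simp: is_unit_poly_iff dvd_field_iff)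
  have "q div g = u" using u \<open>g \<noteq> 0\<close> by simp
  then have "cancel_den (smult a q) q = [:k:]" "cancel_num (smult a q) q = [:a * k:]"
    using k by (simp_all add: cancel_den_def cancel_num_def g_def[symmetric] div_smult_left)
  then show thesis using that k by blast
qed

theorem theorem1p6:
  fixes T :: "'a::complex_hilbert \<Rightarrow> 'a" and c :: complex
  assumes "bounded_clinear T"
    and "numerical_range T \<subseteq> sector (pi / 4)"
    and "\<bar>Im c\<bar> \<le> 1"
    and "\<bar>Re c\<bar> \<le> (1 - \<bar>Im c\<bar>)\<^sup>2 / 200"
  shows "(c \<notin> {\<i>, - \<i>} \<longrightarrow>
            invertible_op (den_op c T) \<and>
            onorm (num_op c T \<circ> inv (den_op c T)) \<le> sqrt 2) \<and>
         (c \<in> {\<i>, - \<i>} \<longrightarrow>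
            invertible_op (poly_op (cancel_den (num_poly c) (den_poly c)) T) \<and>
            onorm (poly_op (cancel_num (num_poly c) (den_poly c)) T \<circ>
                   inv (poly_op (cancel_den (num_poly c) (den_poly c)) T)) \<le> sqrt 2)"
proof (intro conjI impI)
  note T = assms(1) sectorial_if_numerical_range[OF assms(1,2)]
  {
    assume c: "c \<notin> {\<i>, - \<i>}"
    have h: "\<bar>Im c\<bar> < 1"
    proof (rule ccontr)
      assume "\<not> \<bar>Im c\<bar> < 1"
      then have "\<bar>Im c\<bar> = 1" using assms(3) by simp
      then have "Re c = 0" using assms(4) by simp
      then show False using c \<open>\<bar>Im c\<bar> = 1\<close> by (auto simp: complex_eq_iff abs_if split: if_splits)
    qed
    have "(1 - \<bar>Im c\<bar>)\<^sup>2 \<le> 1 - \<bar>Im c\<bar>" using h by (simp add: power2_eq_square mult_left_le)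
    then have "cmod c < 1"
      using cmod_le[of c] assms(4) h by linarith
    then show "invertible_op (den_op c T)" by (rule invertible_den_op[OF T])
    then show "onorm (num_op c T \<circ> inv (den_op c T)) \<le> sqrt 2"
      by (rule onorm_quotient_le) (use norm_num_op_le[OF T assms(3,4)] in simp_all)
  next
    assume c: "c \<in> {\<i>, - \<i>}"
    have "num_poly c = smult (cnj c) (den_poly c)"
      using c by (auto simp: num_poly_def den_poly_def smult_add_right)
    moreover have "den_poly c \<noteq> 0"
    proof
      assume "den_poly c = 0"
      then have "poly (den_poly c) 1 = 0" by simp
      then show False by (simp add: den_poly_def)
    qed
    moreover note cancel_smult[of "den_poly c" "cnj c"]
    ultimately obtain k where k: "k \<noteq> 0" "cancel_den (num_poly c) (den_poly c) = [:k:]"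
        "cancel_num (num_poly c) (den_poly c) = [:cnj c * k:]"
      by auto
    have const: "poly_op [:a:] T = (*\<^sub>C) a" for a by (simp add: poly_op_def fun_eq_iff)
    show inv: "invertible_op (poly_op (cancel_den (num_poly c) (den_poly c)) T)"
      unfolding k const using k(1) by (rule invertible_op_scaleC)
    show "onorm (poly_op (cancel_num (num_poly c) (den_poly c)) T \<circ>
                   inv (poly_op (cancel_den (num_poly c) (den_poly c)) T)) \<le> sqrt 2"
      using inv unfolding k const
    proof (rule onorm_quotient_le)
      have "cmod c = 1" using c by auto
      then have "norm ((cnj c * k) *\<^sub>C x) = 1 * norm (k *\<^sub>C x)" for x :: 'a
        by (simp add: norm_scaleC norm_mult)
      also have "1 * norm (k *\<^sub>C x) \<le> sqrt 2 * norm (k *\<^sub>C x)" for x :: 'a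
        by (rule mult_right_mono) simp_all
      finally show "norm ((cnj c * k) *\<^sub>C x) \<le> sqrt 2 * norm (k *\<^sub>C x)" for x :: 'a .
    qed simp
  }
qed

end
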